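(* Consider a quantum linear system with $n$ oscillators and $m$ input fields, i.e. matrices $(\mathcal{A},\mathcal{B},\mathcal{C})$ with $\mathcal{C}=\Delta(C_-,C_+)$, $\mathcal{B}=-\mathcal{C}^{\flat}$, $\mathcal{A}=-\imath J_n\Omega-\frac12\mathcal{C}^{\flat}\mathcal{C}$, where $C_-,C_+\in\mathbb{C}^{m\times n}$ and $\Omega=\Delta(\Omega_-,\Omega_+)\in\mathbb{C}^{2n\times 2n}$ is Hermitian. If the system is Hurwitz stable (all eigenvalues of $\mathcal{A}$ lie in the open left half plane), then it is both controllable and observable, i.e. $(\mathcal{A},\mathcal{B})$ is controllable and $(\mathcal{A},\mathcal{C})$ is observable.
   Context: Notation: $\imath$ is the imaginary unit; $X^{\#}$ is the entrywise complex conjugate of $X$, $X^\dag=(X^{\#})^\top$; $J_k=\mathrm{diag}(I_k,-I_k)$; for $X\in\mathbb{C}^{2k\times 2r}$, $X^{\flat}=J_rX^\dag J_k$; for $U,V\in\mathbb{C}^{k\times r}$, $\Delta(U,V)=\begin{bmatrix} U & V \\ U^{\#} & V^{\#} \end{bmatrix}$. The quantum linear system with Hamiltonian parameter $\Omega$ and coupling parameters $C_-,C_+$ is $\dot{\breve{\boldsymbol a}}=\mathcal{A}\breve{\boldsymbol a}+\mathcal{B}\breve{\boldsymbol b}$, $\breve{\boldsymbol b}_{\mathrm{out}}=\mathcal{C}\breve{\boldsymbol a}+\breve{\boldsymbol b}$. Controllability and observability are the usual (Kalman rank) notions for matrix pairs. *)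

theory Defs
  imports
    "Jordan_Normal_Form.Schur_Decomposition"
    "Jordan_Normal_Form.DL_Rank"
begin

lemma mat_adjoint_eq_transpose_cnj: "mat_adjoint X = (map_mat cnj X)\<^sup>T"
  by (rule eq_matI) (auto simp: mat_adjoint_def mat_of_rows_def conjugate_complex_def)

definition signature_mat :: "nat \<Rightarrow> complex mat" where
  "signature_mat k = four_block_mat (1\<^sub>m k) (0\<^sub>m k k) (0\<^sub>m k k) (- 1\<^sub>m k)"

text \<open>The flat operation, for \<open>X\<close> of size \<open>2 * k\<close> by \<open>2 * r\<close>.\<close>

definition flat_mat :: "nat \<Rightarrow> nat \<Rightarrow> complex mat \<Rightarrow> complex mat" where
  "flat_mat k r X = signature_mat r * mat_adjoint X * signature_mat k"

definition doubled_up :: "complex mat \<Rightarrow> complex mat \<Rightarrow> complex mat" where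
  "doubled_up U V = four_block_mat U V (map_mat cnj U) (map_mat cnj V)"

definition hermitian_mat :: "complex mat \<Rightarrow> bool" where
  "hermitian_mat X \<longleftrightarrow> mat_adjoint X = X"

definition hurwitz_stable :: "complex mat \<Rightarrow> bool" where
  "hurwitz_stable A \<longleftrightarrow> (\<forall>z. eigenvalue A z \<longrightarrow> Re z < 0)"

text \<open>
  Kalman matrices of a square matrix \<open>A\<close> of size \<open>N = dim_row A\<close>. The first places the blocks
  \<open>B, A * B, \<dots>, A ^ (N - 1) * B\<close> side by side, the second stacks
  \<open>C, C * A, \<dots>, C * A ^ (N - 1)\<close>: \<open>div\<close> selects the block and \<open>mod\<close> the column
  (respectively row) in it.
\<close>

definition controllability_mat :: "complex mat \<Rightarrow> complex mat \<Rightarrow> complex mat" where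
  "controllability_mat A B =
    mat (dim_row A) (dim_row A * dim_col B)
      (\<lambda>(i, j). (A ^\<^sub>m (j div dim_col B) * B) $$ (i, j mod dim_col B))"

definition observability_mat :: "complex mat \<Rightarrow> complex mat \<Rightarrow> complex mat" where
  "observability_mat A C =
    mat (dim_row A * dim_row C) (dim_row A)
      (\<lambda>(i, j). (C * A ^\<^sub>m (i div dim_row C)) $$ (i mod dim_row C, j))"

text \<open>The first argument of \<^const>\<open>vec_space.rank\<close> is the number of rows of the matrix.\<close>

definition controllable :: "complex mat \<Rightarrow> complex mat \<Rightarrow> bool" where
  "controllable A B \<longleftrightarrow> vec_space.rank (dim_row A) (controllability_mat A B) = dim_row A"

definition observable :: "complex mat \<Rightarrow> complex mat \<Rightarrow> bool" where
  "observable A C \<longleftrightarrow>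
    vec_space.rank (dim_row A * dim_row C) (observability_mat A C) = dim_row A"

end

theory Submission
  imports Defs
begin

text \<open>
  The flat operation is an involution reversing products, and \<open>J * \<Omega>\<close> is fixed by it, so
  \<open>A + A\<^sup>\<flat> = - C\<^sup>\<flat> C\<close>. On a vector annihilated by \<open>C\<close> the matrices \<open>A\<close> and \<open>- A\<^sup>\<flat>\<close> agree, while
  \<open>A\<^sup>\<flat> = J A\<^sup>\<dagger> J\<close> has the conjugate spectrum of \<open>A\<close>. If the system is unobservable or uncontrollable,
  the Hautus test yields an eigenvector of \<open>A\<close> or of \<open>A\<^sup>\<flat>\<close> annihilated by \<open>C\<close>, and then
  both \<open>z\<close> and its mirror image \<open>- cnj z\<close> are eigenvalues of \<open>A\<close>: one of them is not in the open left
  half plane.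
\<close>

section \<open>Rank criteria\<close>

text \<open>Padding \<open>M\<close> with zero rows to a square matrix leaves its kernel unchanged
  and makes the determinant vanish.\<close>

lemma underdetermined_kernel:
  fixes M :: "'a :: field mat"
  assumes M: "M \<in> carrier_mat r n" and rn: "r < n"
  obtains v where "v \<in> carrier_vec n" "v \<noteq> 0\<^sub>v n" "M *\<^sub>v v = 0\<^sub>v r"
proof -
  define M' where "M' = mat n n (\<lambda>(i, j). if i < r then M $$ (i, j) else 0)"
  have M': "M' \<in> carrier_mat n n" by (simp add: M'_def)
  \<comment> \<open>Row \<open>r\<close> of \<open>M'\<close> is one of the padded zero rows, so the
    transpose annihilates the corresponding unit vector.\<close>
  have "M'\<^sup>T *\<^sub>v unit_vec n r = 0\<^sub>v n"
    using rn by (intro eq_vecI) (auto simp: M'_def)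
  moreover have "unit_vec n r \<noteq> (0\<^sub>v n :: 'a vec)"
    using rn by (metis index_unit_vec(1) index_zero_vec(1) zero_neq_one)
  ultimately have "det M'\<^sup>T = 0"
    using det_0_iff_vec_prod_zero[of "M'\<^sup>T" n] M' by (metis transpose_carrier_mat unit_vec_carrier)
  then have "det M' = 0" using det_transpose[OF M'] by simp
  then obtain v where v: "v \<in> carrier_vec n" "v \<noteq> 0\<^sub>v n" "M' *\<^sub>v v = 0\<^sub>v n"
    using det_0_iff_vec_prod_zero[OF M'] by auto
  have "M *\<^sub>v v = 0\<^sub>v r"
  proof (rule eq_vecI)
    fix i assume "i < dim_vec (0\<^sub>v r :: 'a vec)"
    then have i: "i < r" by simp
    have "row M i = row M' i" using i rn M by (auto simp: M'_def)
    then have "(M *\<^sub>v v) $ i = (M' *\<^sub>v v) $ i" using i rn M M' by simp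
    then show "(M *\<^sub>v v) $ i = 0\<^sub>v r $ i" using v(3) i rn by simp
  qed (use M in simp)
  with v that show ?thesis by blast
qed

lemma mult_mat_vec_nth:
  assumes "C \<in> carrier_mat r n" "v \<in> carrier_vec n" "i < r"
  shows "(C *\<^sub>v v) $ i = (\<Sum>j<n. C $$ (i, j) * v $ j)"
  using assms by (simp add: scalar_prod_def atLeast0LessThan)

lemma mult_unit_vec:
  fixes M :: "'a :: semiring_1 mat"
  assumes "M \<in> carrier_mat nr nc" "j < nc"
  shows "M *\<^sub>v unit_vec nc j = col M j"
  using assms by (intro eq_vecI) (auto simp: row_def)

text \<open>Independence is a property of the set of columns, which would hide a repetition, so
  distinctness comes first: two equal columns put a difference of unit vectors into the
  kernel.\<close>

lemma full_col_rankI: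
  fixes M :: "'a :: field mat"
  assumes M: "M \<in> carrier_mat nr nc"
    and inj: "\<And>x. x \<in> carrier_vec nc \<Longrightarrow> M *\<^sub>v x = 0\<^sub>v nr \<Longrightarrow> x = 0\<^sub>v nc"
  shows "vec_space.rank nr M = nc"
proof -
  interpret vec_space "TYPE('a)" nr .
  have dist: "distinct (cols M)"
  proof (rule ccontr)
    assume "\<not> distinct (cols M)"
    then obtain i j where ij: "i < nc" "j < nc" "i \<noteq> j" "col M i = col M j"
      using M unfolding distinct_conv_nth by auto
    let ?x = "unit_vec nc i - unit_vec nc j :: 'a vec"
    have "M *\<^sub>v ?x = M *\<^sub>v unit_vec nc i - M *\<^sub>v unit_vec nc j"
      by (rule mult_minus_distrib_mat_vec[OF M]) auto
    also have "\<dots> = col M i - col M j"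
      using ij mult_unit_vec[OF M] by simp
    also have "\<dots> = 0\<^sub>v nr" using ij M by auto
    finally have "?x = 0\<^sub>v nc" by (intro inj) auto
    then have "?x $ i = 0" using ij by simp
    then show False using ij by simp
  qed
  then have "lin_indpt (set (cols M))"
    using lin_depE[OF M] inj by metis
  then show ?thesis using lin_indpt_full_rank[OF M dist] by simp
qed

text \<open>If the rank were below \<open>nr\<close>, fewer than \<open>nr\<close> columns would
  span all of them, and some nonzero vector would be orthogonal to every column, hence lie in the
  kernel of the transpose. Orthogonality is bilinear here, without conjugation.\<close>

lemma full_row_rankI:
  fixes M :: "'a :: field mat"
  assumes M: "M \<in> carrier_mat nr nc"
    and inj: "\<And>x. x \<in> carrier_vec nr \<Longrightarrow> M\<^sup>T *\<^sub>v x = 0\<^sub>v nc \<Longrightarrow> x = 0\<^sub>v nr"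
  shows "vec_space.rank nr M = nr"
proof -
  interpret vec_space "TYPE('a)" nr .
  have carr: "set (cols M) \<subseteq> carrier_vec nr" using M cols_dim by blast
  obtain S where max: "maximal S (\<lambda>T. T \<subseteq> set (cols M) \<and> lin_indpt T)"
    using maximal_exists_superset[of "set (cols M)" "\<lambda>T. T \<subseteq> set (cols M) \<and> lin_indpt T" "{}"]
      finite_lin_indpt2 by auto
  then have S: "S \<subseteq> set (cols M)" "lin_indpt S" by (auto simp: maximal_def)
  then have finS: "finite S" and SV: "S \<subseteq> carrier_vec nr"
    using carr finite_subset by auto
  \<comment> \<open>A column outside the span could be adjoined to \<open>S\<close>, against
    maximality.\<close>
  have span: "c \<in> span S" if c: "c \<in> set (cols M)" for c
  proof (rule ccontr)
    assume n: "c \<notin> span S"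
    then have cS: "c \<notin> S" using in_own_span[OF SV] by auto
    then have "lin_indpt (S \<union> {c})"
      using lin_dep_iff_in_span[OF _ S(2), of c] n SV c carr by auto
    then have "S \<union> {c} = S" using max S(1) c unfolding maximal_def by blast
    then show False using cS by auto
  qed
  have "card S \<le> nr" using li_le_dim(2)[OF fin_dim _ S(2)] SV dim_is_n by auto
  moreover have "\<not> card S < nr"
  proof
    assume lt: "card S < nr"
    obtain ws where ws: "set ws = S" "length ws = card S"
      using finS finite_distinct_list distinct_card by metis
    \<comment> \<open>A kernel vector of the matrix with rows \<open>S\<close> is orthogonal to
      \<open>S\<close>; one exists because there are fewer than \<open>nr\<close> rows.\<close>
    define R where "R = mat_of_rows nr ws"
    have R: "R \<in> carrier_mat (card S) nr" using ws by (simp add: R_def mat_of_rows_def)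
    obtain v where v: "v \<in> carrier_vec nr" "v \<noteq> 0\<^sub>v nr" "R *\<^sub>v v = 0\<^sub>v (card S)"
      using underdetermined_kernel[OF R lt] by blast
    have "s \<bullet> v = 0" if "s \<in> S" for s
    proof -
      have "s \<in> set ws" using that ws(1) by simp
      then obtain i where i: "i < length ws" "ws ! i = s" unfolding in_set_conv_nth by auto
      moreover have "s \<in> carrier_vec nr" using that SV by auto
      ultimately have "row R i = s" using mat_of_rows_row[of i ws nr] unfolding R_def by simp
      moreover have ir: "i < card S" using i(1) ws(2) by simp
      ultimately have "s \<bullet> v = (R *\<^sub>v v) $ i" using R by simp
      then show ?thesis unfolding v(3) using ir by simp
    qed
    then have "v \<in> orthogonal_complement S"
      using SV v(1) unfolding orthogonal_complement_def by (auto simp: comm_scalar_prod[OF v(1)])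
    then have "v \<in> orthogonal_complement (span S)" using SV by simp
    then have z: "v \<bullet> c = 0" if "c \<in> set (cols M)" for c
      using span[OF that] unfolding orthogonal_complement_def by auto
    have "M\<^sup>T *\<^sub>v v = 0\<^sub>v nc"
    proof (rule eq_vecI)
      fix i assume "i < dim_vec (0\<^sub>v nc :: 'a vec)"
      then have i: "i < nc" by simp
      then have c: "col M i \<in> set (cols M)" using M by (auto simp: cols_def)
      then have "col M i \<bullet> v = 0"
        using z[OF c] comm_scalar_prod[OF v(1), of "col M i"] carr by auto
      then show "(M\<^sup>T *\<^sub>v v) $ i = 0\<^sub>v nc $ i" using i M by simp
    qed (use M in simp)
    then show False using inj v by auto
  qed
  ultimately show ?thesis using rank_card_indpt[OF M max] by simp
qed

section \<open>The Hautus test\<close>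

lemma pow_mat_Suc_left:
  fixes A :: "'a :: semiring_1 mat"
  assumes "A \<in> carrier_mat N N"
  shows "A ^\<^sub>m Suc k = A * A ^\<^sub>m k"
proof (induction k)
  case 0
  then show ?case using assms by simp
next
  case (Suc k)
  have "A ^\<^sub>m Suc (Suc k) = A * A ^\<^sub>m k * A" using Suc by simp
  also have "\<dots> = A * A ^\<^sub>m Suc k"
    using assoc_mult_mat[OF assms pow_carrier_mat[OF assms] assms] by simp
  finally show ?case .
qed

lemma transpose_pow_mat:
  fixes A :: "'a :: comm_semiring_1 mat"
  assumes "A \<in> carrier_mat N N"
  shows "(A ^\<^sub>m k)\<^sup>T = A\<^sup>T ^\<^sub>m k"
proof (induction k)
  case 0
  then show ?case using assms by simp
next
  case (Suc k)
  have "(A ^\<^sub>m Suc k)\<^sup>T = A\<^sup>T * (A ^\<^sub>m k)\<^sup>T"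
    using transpose_mult[OF pow_carrier_mat[OF assms] assms] by simp
  then show ?case using Suc pow_mat_Suc_left[of "A\<^sup>T" N k] assms by simp
qed

text \<open>The combination \<open>p(A) x\<close> for \<open>degree p \<le> N\<close>. The fixed summation range makes it linear in \<open>p\<close>.\<close>

definition krylov_vec :: "nat \<Rightarrow> complex mat \<Rightarrow> complex vec \<Rightarrow> complex poly \<Rightarrow> complex vec" where
  "krylov_vec N A x p = vec N (\<lambda>i. \<Sum>k\<le>N. coeff p k * (A ^\<^sub>m k *\<^sub>v x) $ i)"

lemma krylov_vec_carrier [simp]: "krylov_vec N A x p \<in> carrier_vec N"
  by (simp add: krylov_vec_def)

text \<open>Linearity of \<open>C\<close>, entry by entry. It serves both for the state matrix, with
  \<open>C\<close> taken as \<open>A\<close>, and for the output matrix.\<close>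

lemma mult_krylov_vec:
  assumes C: "C \<in> carrier_mat r N" and A: "A \<in> carrier_mat N N" and x: "x \<in> carrier_vec N"
    and i: "i < r"
  shows "(C *\<^sub>v krylov_vec N A x p) $ i = (\<Sum>k\<le>N. coeff p k * (C *\<^sub>v (A ^\<^sub>m k *\<^sub>v x)) $ i)"
proof -
  have pow: "A ^\<^sub>m k *\<^sub>v x \<in> carrier_vec N" for k
    using mult_mat_vec_carrier[OF pow_carrier_mat[OF A] x] .
  have "(C *\<^sub>v krylov_vec N A x p) $ i
      = (\<Sum>j<N. \<Sum>k\<le>N. coeff p k * (C $$ (i, j) * (A ^\<^sub>m k *\<^sub>v x) $ j))"
    unfolding mult_mat_vec_nth[OF C krylov_vec_carrier i]
    by (simp add: krylov_vec_def sum_distrib_left mult_ac)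
  also have "\<dots> = (\<Sum>k\<le>N. \<Sum>j<N. coeff p k * (C $$ (i, j) * (A ^\<^sub>m k *\<^sub>v x) $ j))"
    by (rule sum.swap)
  also have "\<dots> = (\<Sum>k\<le>N. coeff p k * (C *\<^sub>v (A ^\<^sub>m k *\<^sub>v x)) $ i)"
    unfolding mult_mat_vec_nth[OF C pow i] by (simp add: sum_distrib_left)
  finally show ?thesis .
qed

text \<open>This is \<open>(A - z) q(A) x\<close>. The strict degree bound ensures that the product
  still fits into the summation range up to \<open>N\<close>.\<close>

lemma krylov_vec_linear_factor:
  assumes A: "A \<in> carrier_mat N N" and x: "x \<in> carrier_vec N" and deg: "degree q < N"
  shows "krylov_vec N A x ([:- z, 1:] * q) = A *\<^sub>v krylov_vec N A x q - z \<cdot>\<^sub>v krylov_vec N A x q"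
proof (rule eq_vecI)
  fix i assume "i < dim_vec (A *\<^sub>v krylov_vec N A x q - z \<cdot>\<^sub>v krylov_vec N A x q)"
  then have i: "i < N" by (simp add: krylov_vec_def)
  define f where "f k = (A ^\<^sub>m k *\<^sub>v x) $ i" for k
  have f: "(A *\<^sub>v (A ^\<^sub>m k *\<^sub>v x)) $ i = f (Suc k)" for k
    unfolding f_def pow_mat_Suc_left[OF A]
    using assoc_mult_mat_vec[OF A pow_carrier_mat[OF A] x] by simp
  \<comment> \<open>With the top coefficient zero, the index shift caused by multiplication with the
    variable loses no term.\<close>
  have cN: "coeff q N = 0" using deg by (simp add: coeff_eq_0)
  have shift: "(\<Sum>k\<le>N. coeff (pCons 0 q) k * f k) = (\<Sum>k\<le>N. coeff q k * f (Suc k))"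
  proof -
    have "(\<Sum>k\<le>N. coeff (pCons 0 q) k * f k) = (\<Sum>k<N. coeff q k * f (Suc k))"
      by (simp add: sum.atMost_shift)
    also have "\<dots> = (\<Sum>k\<le>N. coeff q k * f (Suc k))"
      using cN by (simp add: lessThan_Suc_atMost[symmetric])
    finally show ?thesis .
  qed
  have "[:- z, 1:] * q = pCons 0 q - smult z q" by simp
  then have "krylov_vec N A x ([:- z, 1:] * q) $ i
      = (\<Sum>k\<le>N. coeff (pCons 0 q) k * f k) - z * (\<Sum>k\<le>N. coeff q k * f k)"
    using i by (simp add: krylov_vec_def f_def[symmetric] left_diff_distrib sum_subtractf
        sum_distrib_left mult.assoc)
  also have "\<dots> = (A *\<^sub>v krylov_vec N A x q) $ i - z * krylov_vec N A x q $ i"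
    unfolding shift mult_krylov_vec[OF A A x i] f
    using i by (simp add: krylov_vec_def f_def)
  finally show "krylov_vec N A x ([:- z, 1:] * q) $ i
      = (A *\<^sub>v krylov_vec N A x q - z \<cdot>\<^sub>v krylov_vec N A x q) $ i"
    using i A by (simp add: krylov_vec_def)
qed (use A in \<open>simp add: krylov_vec_def\<close>)

text \<open>Take \<open>p\<close> of least degree with \<open>p(A) x = 0\<close>, split off a root
  as \<open>p = (X - z) q\<close>, and set \<open>y = q(A) x\<close>. Minimality makes
  \<open>y\<close> nonzero, \<open>(A - z) y = 0\<close>, and \<open>y\<close> combines only powers
  of \<open>A\<close> below \<open>N\<close> applied to \<open>x\<close>, all annihilated by
  \<open>C\<close>.\<close>

lemma unobservable_eigenvector:
  fixes A C :: "complex mat"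
  assumes A: "A \<in> carrier_mat N N" and C: "C \<in> carrier_mat r N"
    and x: "x \<in> carrier_vec N" "x \<noteq> 0\<^sub>v N"
    and unobs: "\<And>k. k < N \<Longrightarrow> C *\<^sub>v (A ^\<^sub>m k *\<^sub>v x) = 0\<^sub>v r"
  obtains y z where "eigenvector A y z" "C *\<^sub>v y = 0\<^sub>v r"
proof -
  let ?K = "krylov_vec N A x"
  let ?P = "\<lambda>p. p \<noteq> 0 \<and> degree p \<le> N \<and> ?K p = 0\<^sub>v N"
  \<comment> \<open>The \<open>N + 1\<close> Krylov vectors as columns: in dimension
    \<open>N\<close> they are dependent, and the coefficients of a dependency form an annihilating
    polynomial.\<close>
  define M where "M = mat N (Suc N) (\<lambda>(i, k). (A ^\<^sub>m k *\<^sub>v x) $ i)"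
  have "M \<in> carrier_mat N (Suc N)" by (simp add: M_def)
  then obtain v where v: "v \<in> carrier_vec (Suc N)" "v \<noteq> 0\<^sub>v (Suc N)" "M *\<^sub>v v = 0\<^sub>v N"
    using underdetermined_kernel[of M N "Suc N"] by auto
  define p0 where "p0 = Poly (list_of_vec v)"
  have coeff_p0: "coeff p0 k = (if k \<le> N then v $ k else 0)" for k
    using v(1) by (auto simp: p0_def coeff_Poly_eq nth_default_def list_of_vec_index)
  have "?K p0 = M *\<^sub>v v"
    using v(1) by (intro eq_vecI) (auto simp: krylov_vec_def M_def scalar_prod_def coeff_p0
        atLeast0LessThan lessThan_Suc_atMost mult_ac intro!: sum.cong)
  moreover have "p0 \<noteq> 0"
  proof
    assume "p0 = 0"
    then have "v $ k = 0" if "k \<le> N" for k using coeff_p0[of k] that by simp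
    then have "v = 0\<^sub>v (Suc N)" using v(1) by (intro eq_vecI) auto
    then show False using v(2) by simp
  qed
  moreover have "degree p0 \<le> N" by (rule degree_le) (simp add: coeff_p0)
  ultimately have "?P p0" using v(3) by simp
  then obtain p where p: "?P p" and least: "\<And>q. ?P q \<Longrightarrow> degree p \<le> degree q"
    using arg_min_nat_lemma[of ?P p0 degree] by blast
  \<comment> \<open>A nonzero constant \<open>c\<close> would give \<open>c x = 0\<close> with
    \<open>x\<close> nonzero.\<close>
  have "degree p \<noteq> 0"
  proof
    assume "degree p = 0"
    then obtain c where c: "p = [:c:]" by (rule degree_eq_zeroE)
    have "(\<Sum>k\<le>N. coeff [:c:] k * (A ^\<^sub>m k *\<^sub>v x) $ i) = c * (A ^\<^sub>m 0 *\<^sub>v x) $ i" for i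
      by (simp add: sum.atMost_shift)
    then have "?K p = c \<cdot>\<^sub>v x"
      using x A c by (intro eq_vecI) (auto simp: krylov_vec_def)
    moreover have "c \<noteq> 0" using p c by auto
    ultimately have "x $ i = 0" if "i < N" for i
      using p x(1) that by (metis carrier_vecD index_smult_vec(1) index_zero_vec(1) mult_eq_0_iff)
    then have "x = 0\<^sub>v N" using x(1) by (intro eq_vecI) auto
    then show False using x(2) by simp
  qed
  then have "\<not> constant (poly p)" by (simp add: constant_degree)
  then obtain z where "poly p z = 0" using fundamental_theorem_of_algebra by blast
  then obtain q where q: "p = [:- z, 1:] * q" by (auto simp: poly_eq_0_iff_dvd dvd_def)
  then have q0: "q \<noteq> 0" and degq: "degree p = Suc (degree q)"
    using p by (auto simp: degree_mult_eq simp del: mult_pCons_left)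
  have y0: "?K q \<noteq> 0\<^sub>v N" using least[of q] q0 p degq by auto
  have "A *\<^sub>v ?K q - z \<cdot>\<^sub>v ?K q = 0\<^sub>v N"
    using krylov_vec_linear_factor[OF A x(1), of q z] p degq q by simp
  then have "(A *\<^sub>v ?K q - z \<cdot>\<^sub>v ?K q) $ i = 0" if "i < N" for i using that by simp
  then have "A *\<^sub>v ?K q = z \<cdot>\<^sub>v ?K q"
    using A by (intro eq_vecI) (auto simp: krylov_vec_def simp del: index_mult_mat_vec)
  then have "eigenvector A (?K q) z" using A y0 by (simp add: eigenvector_def)
  moreover have "C *\<^sub>v ?K q = 0\<^sub>v r"
  proof (rule eq_vecI)
    fix i assume "i < dim_vec (0\<^sub>v r :: complex vec)"
    then have i: "i < r" by simp
    \<comment> \<open>The hypothesis covers \<open>k < N\<close>; at \<open>k = N\<close> the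
      coefficient vanishes because \<open>q\<close> has degree below \<open>N\<close>.\<close>
    have "coeff q k * (C *\<^sub>v (A ^\<^sub>m k *\<^sub>v x)) $ i = 0" if "k \<le> N" for k
    proof (cases "k < N")
      case True
      then show ?thesis using unobs i by (simp del: index_mult_mat_vec)
    next
      case False
      then have "degree q < k" using degq p by simp
      then show ?thesis by (simp add: coeff_eq_0)
    qed
    then have "(C *\<^sub>v ?K q) $ i = 0"
      unfolding mult_krylov_vec[OF C A x(1) i] by (intro sum.neutral) blast
    then show "(C *\<^sub>v ?K q) $ i = 0\<^sub>v r $ i" using i by simp
  qed (use C in simp)
  ultimately show ?thesis by (rule that)
qed

section \<open>Kalman rank from the eigenvector test\<close>

lemma block_index_less:
  fixes k r p N :: nat
  assumes "k < N" "r < p"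
  shows "k * p + r < N * p"
proof -
  have "k * p + r < Suc k * p" using assms by simp
  also have "\<dots> \<le> N * p" using assms by (intro mult_le_mono1) simp
  finally show ?thesis .
qed

text \<open>A nonzero kernel vector of the Kalman matrix is an unobservable state, which
  \<open>unobservable_eigenvector\<close> turns into an eigenvector that fails the test.\<close>

lemma observable_hautusI:
  assumes A: "A \<in> carrier_mat N N" and C: "C \<in> carrier_mat p N"
    and test: "\<And>y z. eigenvector A y z \<Longrightarrow> C *\<^sub>v y \<noteq> 0\<^sub>v p"
  shows "observable A C"
proof -
  let ?O = "observability_mat A C"
  have O: "?O \<in> carrier_mat (N * p) N" using A C by (simp add: observability_mat_def)
  have "x = 0\<^sub>v N" if x: "x \<in> carrier_vec N" "?O *\<^sub>v x = 0\<^sub>v (N * p)" for x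
  proof (rule ccontr)
    assume x0: "x \<noteq> 0\<^sub>v N"
    have "C *\<^sub>v (A ^\<^sub>m k *\<^sub>v x) = 0\<^sub>v p" if k: "k < N" for k
    proof (rule eq_vecI)
      fix r assume "r < dim_vec (0\<^sub>v p :: complex vec)"
      then have r: "r < p" by simp
      \<comment> \<open>The position of row \<open>r\<close> of block \<open>k\<close>: division by
        \<open>p\<close> returns \<open>k\<close> and the remainder is \<open>r\<close>.\<close>
      let ?i = "k * p + r"
      have i: "?i < N * p" by (rule block_index_less[OF k r])
      have "row ?O ?i = row (C * A ^\<^sub>m k) r"
        using A C i r mult_carrier_mat[OF C pow_carrier_mat[OF A, of k]]
        by (intro eq_vecI) (auto simp: observability_mat_def simp del: index_mult_mat(1) split: if_splits)
      then have "(C * A ^\<^sub>m k *\<^sub>v x) $ r = (?O *\<^sub>v x) $ ?i"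
        using O i r C by simp
      then show "(C *\<^sub>v (A ^\<^sub>m k *\<^sub>v x)) $ r = 0\<^sub>v p $ r"
        using x i r assoc_mult_mat_vec[OF C pow_carrier_mat[OF A] x(1)] by simp
    qed (use C in simp)
    then show False using unobservable_eigenvector[OF A C x(1) x0] test by metis
  qed
  then show ?thesis using full_col_rankI[OF O] A C by (simp add: observable_def)
qed

text \<open>Dual to observability: the transposed Kalman matrix stacks the blocks of the pair of
  \<open>A\<^sup>T\<close> and \<open>B\<^sup>T\<close>. The plain transpose is used, so left
  eigenvectors appear unconjugated.\<close>

lemma controllable_hautusI:
  assumes A: "A \<in> carrier_mat N N" and B: "B \<in> carrier_mat N p"
    and test: "\<And>y z. eigenvector A\<^sup>T y z \<Longrightarrow> B\<^sup>T *\<^sub>v y \<noteq> 0\<^sub>v p"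
  shows "controllable A B"
proof -
  let ?K = "controllability_mat A B"
  have AT: "A\<^sup>T \<in> carrier_mat N N" and BT: "B\<^sup>T \<in> carrier_mat p N" using A B by auto
  have K: "?K \<in> carrier_mat N (N * p)" using A B by (simp add: controllability_mat_def)
  have "x = 0\<^sub>v N" if x: "x \<in> carrier_vec N" "?K\<^sup>T *\<^sub>v x = 0\<^sub>v (N * p)" for x
  proof (rule ccontr)
    assume x0: "x \<noteq> 0\<^sub>v N"
    have "B\<^sup>T *\<^sub>v (A\<^sup>T ^\<^sub>m k *\<^sub>v x) = 0\<^sub>v p" if k: "k < N" for k
    proof (rule eq_vecI)
      fix r assume "r < dim_vec (0\<^sub>v p :: complex vec)"
      then have r: "r < p" by simp
      let ?i = "k * p + r"
      have i: "?i < N * p" by (rule block_index_less[OF k r])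
      have "col ?K ?i = col (A ^\<^sub>m k * B) r"
        using A B i r by (intro eq_vecI) (auto simp: controllability_mat_def)
      then have "((A ^\<^sub>m k * B)\<^sup>T *\<^sub>v x) $ r = (?K\<^sup>T *\<^sub>v x) $ ?i"
        using K i r B by simp
      moreover have "(A ^\<^sub>m k * B)\<^sup>T = B\<^sup>T * A\<^sup>T ^\<^sub>m k"
        using transpose_mult[OF pow_carrier_mat[OF A] B] transpose_pow_mat[OF A] by simp
      ultimately show "(B\<^sup>T *\<^sub>v (A\<^sup>T ^\<^sub>m k *\<^sub>v x)) $ r = 0\<^sub>v p $ r"
        using x i r assoc_mult_mat_vec[OF BT pow_carrier_mat[OF AT] x(1)] by simp
    qed (use B in simp)
    then show False using unobservable_eigenvector[OF AT BT x(1) x0] test by metis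
  qed
  then show ?thesis using full_row_rankI[OF K] A B by (simp add: controllable_def)
qed

section \<open>The flat involution\<close>

lemma signature_mat_carrier [simp]: "signature_mat k \<in> carrier_mat (k + k) (k + k)"
  by (simp add: signature_mat_def)

lemma signature_mat_square: "signature_mat k * signature_mat k = 1\<^sub>m (k + k)"
  unfolding signature_mat_def
  by (subst mult_four_block_mat[of _ k k _ k _ k _ _ k _ k]) (auto, intro eq_matI, auto)

lemma mat_adjoint_signature: "mat_adjoint (signature_mat k) = signature_mat k"
  unfolding mat_adjoint_eq_transpose_cnj signature_mat_def
  by (intro eq_matI) auto

lemma mat_adjoint_carrier:
  fixes X :: "complex mat"
  shows "X \<in> carrier_mat a b \<Longrightarrow> mat_adjoint X \<in> carrier_mat b a"
  unfolding mat_adjoint_eq_transpose_cnj by simp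

lemma mat_adjoint_mult:
  fixes X Y :: "complex mat"
  assumes "X \<in> carrier_mat a b" "Y \<in> carrier_mat b c"
  shows "mat_adjoint (X * Y) = mat_adjoint Y * mat_adjoint X"
  using assms unfolding mat_adjoint_eq_transpose_cnj
  by (intro eq_matI) (auto simp: scalar_prod_def mult.commute)

lemma mat_adjoint_adjoint: "mat_adjoint (mat_adjoint X) = (X :: complex mat)"
  unfolding mat_adjoint_eq_transpose_cnj by (intro eq_matI) auto

lemma flat_mat_carrier: "X \<in> carrier_mat (k + k) (r + r) \<Longrightarrow> flat_mat k r X \<in> carrier_mat (r + r) (k + k)"
  unfolding flat_mat_def
  by (rule mult_carrier_mat[OF mult_carrier_mat[OF signature_mat_carrier mat_adjoint_carrier] signature_mat_carrier])

lemma signature_mult_cancel: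
  assumes "X \<in> carrier_mat (k + k) c"
  shows "signature_mat k * (signature_mat k * X) = X"
  using assoc_mult_mat[OF signature_mat_carrier signature_mat_carrier assms] signature_mat_square assms
  by (metis left_mult_one_mat)

lemma signature_mult_vec_cancel:
  assumes "v \<in> carrier_vec (k + k)"
  shows "signature_mat k *\<^sub>v (signature_mat k *\<^sub>v v) = v"
  using assoc_mult_mat_vec[OF signature_mat_carrier signature_mat_carrier assms] signature_mat_square assms
  by (metis one_mult_mat_vec)

text \<open>The two inner factors \<open>signature_mat l\<close> meet and cancel.\<close>

lemma flat_mat_mult:
  assumes X: "X \<in> carrier_mat (k + k) (l + l)" and Y: "Y \<in> carrier_mat (l + l) (r + r)"
  shows "flat_mat k r (X * Y) = flat_mat l r Y * flat_mat k l X"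
proof -
  let ?J = "signature_mat"
  note X' = mat_adjoint_carrier[OF X] and Y' = mat_adjoint_carrier[OF Y]
    and J = signature_mat_carrier
  note XJ = mult_carrier_mat[OF X' J] and JY = mult_carrier_mat[OF J Y']
  have "?J l * mat_adjoint X * ?J k = ?J l * (mat_adjoint X * ?J k)"
    by (rule assoc_mult_mat[OF J X' J])
  then have "flat_mat l r Y * flat_mat k l X
      = ?J r * mat_adjoint Y * (?J l * (?J l * (mat_adjoint X * ?J k)))"
    using assoc_mult_mat[OF JY J mult_carrier_mat[OF J XJ]] by (simp add: flat_mat_def)
  also have "\<dots> = ?J r * mat_adjoint Y * (mat_adjoint X * ?J k)"
    by (simp only: signature_mult_cancel[OF XJ])
  also have "\<dots> = ?J r * (mat_adjoint Y * mat_adjoint X) * ?J k"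
    using assoc_mult_mat[OF JY X' J] assoc_mult_mat[OF J Y' X'] by simp
  finally show ?thesis by (simp add: flat_mat_def mat_adjoint_mult[OF X Y])
qed

lemma flat_mat_flat:
  assumes X: "X \<in> carrier_mat (k + k) (r + r)"
  shows "flat_mat r k (flat_mat k r X) = X"
proof -
  let ?J = "signature_mat"
  note X' = mat_adjoint_carrier[OF X]
  have JX: "?J r * mat_adjoint X \<in> carrier_mat (r + r) (k + k)" by (rule mult_carrier_mat[OF signature_mat_carrier X'])
  have XJ: "X * ?J r \<in> carrier_mat (k + k) (r + r)" by (rule mult_carrier_mat[OF X signature_mat_carrier])
  have "mat_adjoint (flat_mat k r X) = ?J k * (X * ?J r)"
    unfolding flat_mat_def mat_adjoint_mult[OF JX signature_mat_carrier]
      mat_adjoint_mult[OF signature_mat_carrier X'] mat_adjoint_signature mat_adjoint_adjoint ..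
  then have "flat_mat r k (flat_mat k r X) = X * ?J r * ?J r"
    using signature_mult_cancel[OF XJ] by (simp add: flat_mat_def)
  also have "\<dots> = X"
    unfolding assoc_mult_mat[OF X signature_mat_carrier signature_mat_carrier] signature_mat_square
    using X by simp
  finally show ?thesis .
qed

text \<open>Conjugate linearity, in the shape in which the state matrix combines its Hamiltonian and
  dissipative parts.\<close>

lemma flat_mat_linear:
  assumes X: "X \<in> carrier_mat (k + k) (r + r)" and Y: "Y \<in> carrier_mat (k + k) (r + r)"
  shows "flat_mat k r (a \<cdot>\<^sub>m X - b \<cdot>\<^sub>m Y) = cnj a \<cdot>\<^sub>m flat_mat k r X - cnj b \<cdot>\<^sub>m flat_mat k r Y"
proof -
  let ?J = "signature_mat"
  note [simp] = mat_adjoint_carrier[OF X] mat_adjoint_carrier[OF Y]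
  have "mat_adjoint (a \<cdot>\<^sub>m X - b \<cdot>\<^sub>m Y) = cnj a \<cdot>\<^sub>m mat_adjoint X - cnj b \<cdot>\<^sub>m mat_adjoint Y"
    using X Y unfolding mat_adjoint_eq_transpose_cnj by (intro eq_matI) auto
  moreover have "?J r * (cnj a \<cdot>\<^sub>m mat_adjoint X - cnj b \<cdot>\<^sub>m mat_adjoint Y)
      = cnj a \<cdot>\<^sub>m (?J r * mat_adjoint X) - cnj b \<cdot>\<^sub>m (?J r * mat_adjoint Y)"
    by (simp add: mult_minus_distrib_mat[of _ "r + r" "r + r" _ "k + k"]
        mult_smult_distrib[of _ "r + r" "r + r" _ "k + k"])
  moreover have "(cnj a \<cdot>\<^sub>m (?J r * mat_adjoint X) - cnj b \<cdot>\<^sub>m (?J r * mat_adjoint Y)) * ?J k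
      = cnj a \<cdot>\<^sub>m (?J r * mat_adjoint X * ?J k) - cnj b \<cdot>\<^sub>m (?J r * mat_adjoint Y * ?J k)"
    by (simp add: minus_mult_distrib_mat[of _ "r + r" "k + k" _ _ "k + k"]
        mult_smult_assoc_mat[of _ "r + r" "k + k" _ "k + k"] mult_carrier_mat[of _ _ "r + r"])
  ultimately show ?thesis by (simp add: flat_mat_def)
qed

text \<open>Adjacent signatures cancel, and the adjoint acts on a conjugated vector as the conjugate
  of the transpose. This carries left null vectors and left eigenvectors of \<open>X\<close> to
  right ones of its flat.\<close>

lemma flat_mat_mult_vec:
  assumes X: "X \<in> carrier_mat (k + k) (r + r)" and y: "y \<in> carrier_vec (k + k)"
  shows "flat_mat k r X *\<^sub>v (signature_mat k *\<^sub>v map_vec cnj y)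
    = signature_mat r *\<^sub>v map_vec cnj (X\<^sup>T *\<^sub>v y)"
proof -
  let ?J = "signature_mat" and ?y = "map_vec cnj y"
  have y': "?y \<in> carrier_vec (k + k)" using y by simp
  note X' = mat_adjoint_carrier[OF X]
  note J = signature_mat_carrier
  have "flat_mat k r X *\<^sub>v (?J k *\<^sub>v ?y) = ?J r * mat_adjoint X *\<^sub>v (?J k *\<^sub>v (?J k *\<^sub>v ?y))"
    unfolding flat_mat_def
    by (rule assoc_mult_mat_vec[OF mult_carrier_mat[OF J X'] J mult_mat_vec_carrier[OF J y']])
  also have "\<dots> = ?J r *\<^sub>v (mat_adjoint X *\<^sub>v ?y)"
    unfolding signature_mult_vec_cancel[OF y'] by (rule assoc_mult_mat_vec[OF J X' y'])
  also have "mat_adjoint X *\<^sub>v ?y = map_vec cnj (X\<^sup>T *\<^sub>v y)"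
    using X y by (intro eq_vecI) (auto simp: mat_adjoint_eq_transpose_cnj scalar_prod_def)
  finally show ?thesis .
qed

lemma eigenvector_flat:
  assumes X: "X \<in> carrier_mat (n + n) (n + n)" and y: "eigenvector X\<^sup>T y z"
  shows "eigenvector (flat_mat n n X) (signature_mat n *\<^sub>v map_vec cnj y) (cnj z)"
proof -
  let ?v = "signature_mat n *\<^sub>v map_vec cnj y"
  have y: "y \<in> carrier_vec (n + n)" "y \<noteq> 0\<^sub>v (n + n)" "X\<^sup>T *\<^sub>v y = z \<cdot>\<^sub>v y"
    using y X by (auto simp: eigenvector_def)
  have y': "map_vec cnj y \<in> carrier_vec (n + n)" using y by simp
  have "?v \<noteq> 0\<^sub>v (n + n)"
  proof
    assume "?v = 0\<^sub>v (n + n)"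
    \<comment> \<open>The signature is its own inverse, so a vanishing image forces the conjugate of
      \<open>y\<close> to vanish.\<close>
    then have "map_vec cnj y = signature_mat n *\<^sub>v 0\<^sub>v (n + n)"
      using signature_mult_vec_cancel[OF y'] by simp
    also have "\<dots> = 0\<^sub>v (n + n)" by (intro eq_vecI) (auto simp: signature_mat_def)
    finally have 0: "map_vec cnj y = 0\<^sub>v (n + n)" .
    have "y $ i = 0" if "i < n + n" for i
      using arg_cong[OF 0, of "\<lambda>v. v $ i"] that y(1) by simp
    then show False using y(1,2) by (auto intro: eq_vecI)
  qed
  moreover have "flat_mat n n X *\<^sub>v ?v = cnj z \<cdot>\<^sub>v ?v"
  proof -
    have "map_vec cnj (z \<cdot>\<^sub>v y) = cnj z \<cdot>\<^sub>v map_vec cnj y" by (intro eq_vecI) auto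
    then show ?thesis
      using flat_mat_mult_vec[OF X y(1)] y(3) mult_mat_vec[OF signature_mat_carrier y'] by simp
  qed
  moreover have "?v \<in> carrier_vec (n + n)" by (rule mult_mat_vec_carrier[OF signature_mat_carrier y'])
  ultimately show ?thesis using flat_mat_carrier[OF X] by (simp add: eigenvector_def)
qed

section \<open>Spectra under the flat operation and the dissipation identity\<close>

lemma eigenvalue_transpose:
  fixes A :: "'a :: field mat"
  assumes "A \<in> carrier_mat N N"
  shows "eigenvalue A\<^sup>T z \<longleftrightarrow> eigenvalue A z"
  using assms eigenvalue_root_char_poly[of "A\<^sup>T" N z] eigenvalue_root_char_poly[OF assms, of z] by simp

text \<open>A left eigenvector of the flat becomes a right eigenvector of the double flat, which is
  \<open>X\<close>.\<close>

lemma eigenvalue_flat: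
  assumes X: "X \<in> carrier_mat (n + n) (n + n)" and ev: "eigenvalue (flat_mat n n X) z"
  shows "eigenvalue X (cnj z)"
proof -
  have F: "flat_mat n n X \<in> carrier_mat (n + n) (n + n)" by (rule flat_mat_carrier[OF X])
  obtain y where "eigenvector (flat_mat n n X)\<^sup>T y z"
    using ev eigenvalue_transpose[OF F] by (auto simp: eigenvalue_def)
  then show ?thesis
    using eigenvector_flat[OF F] flat_mat_flat[OF X] by (auto simp: eigenvalue_def)
qed

text \<open>The adjoint of \<open>J * \<Omega>\<close> is \<open>\<Omega> * J\<close>; of the three
  signatures that then occur, the two on the right cancel.\<close>

lemma flat_mat_signature_hermitian:
  assumes "\<Omega> \<in> carrier_mat (n + n) (n + n)" "hermitian_mat \<Omega>"
  shows "flat_mat n n (signature_mat n * \<Omega>) = signature_mat n * \<Omega>"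
proof -
  let ?J = "signature_mat n"
  have "flat_mat n n (?J * \<Omega>) = ?J * (\<Omega> * ?J) * ?J"
    using assms(2) mat_adjoint_mult[OF signature_mat_carrier assms(1)]
    by (simp add: flat_mat_def mat_adjoint_signature hermitian_mat_def)
  also have "\<dots> = ?J * (\<Omega> * (?J * ?J))"
    using assms(1) by (simp add: assoc_mult_mat[of _ "n + n" "n + n" _ "n + n" _ "n + n"]
        mult_carrier_mat[of _ _ "n + n"])
  finally show ?thesis using assms(1) by (simp add: signature_mat_square)
qed

text \<open>Applied to a vector in the kernel of \<open>C\<close>, the right-hand side of the
  dissipation identity vanishes.\<close>

lemma flat_mult_uncoupled_vec:
  assumes A: "A \<in> carrier_mat (n + n) (n + n)" and C: "C \<in> carrier_mat (m + m) (n + n)"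
    and dissipation: "A + flat_mat n n A = - (flat_mat m n C * C)"
    and v: "v \<in> carrier_vec (n + n)" "C *\<^sub>v v = 0\<^sub>v (m + m)"
  shows "flat_mat n n A *\<^sub>v v = - (A *\<^sub>v v)"
proof -
  note F = flat_mat_carrier[OF A] and G = flat_mat_carrier[OF C]
  have "A *\<^sub>v v + flat_mat n n A *\<^sub>v v = - (flat_mat m n C * C *\<^sub>v v)"
    using add_mult_distrib_mat_vec[OF A F v(1)] dissipation v(1) C
    by simp
  also have "flat_mat m n C * C *\<^sub>v v = flat_mat m n C *\<^sub>v 0\<^sub>v (m + m)"
    using assoc_mult_mat_vec[OF G C v(1)] v(2) by simp
  also have "- \<dots> = 0\<^sub>v (n + n)" using G by (intro eq_vecI) auto
  finally have 0: "A *\<^sub>v v + flat_mat n n A *\<^sub>v v = 0\<^sub>v (n + n)" .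
  show ?thesis
  proof (rule eq_vecI)
    fix i assume "i < dim_vec (- (A *\<^sub>v v))"
    then have "i < n + n" using A by simp
    then have "(A *\<^sub>v v) $ i + (flat_mat n n A *\<^sub>v v) $ i = 0"
      using arg_cong[OF 0, of "\<lambda>v. v $ i"] A F by (simp del: index_mult_mat_vec)
    then show "(flat_mat n n A *\<^sub>v v) $ i = (- (A *\<^sub>v v)) $ i"
      using A \<open>i < n + n\<close> by (simp del: index_mult_mat_vec add: eq_neg_iff_add_eq_0 add.commute)
  qed (use A F in simp)
qed

theorem theorem3p1:
  fixes n m :: nat
    and C_minus C_plus \<Omega>_minus \<Omega>_plus \<Omega> \<A> \<B> \<C> :: "complex mat"
  assumes "C_minus \<in> carrier_mat m n" and "C_plus \<in> carrier_mat m n"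
    and "\<Omega>_minus \<in> carrier_mat n n" and "\<Omega>_plus \<in> carrier_mat n n"
    and "\<Omega> = doubled_up \<Omega>_minus \<Omega>_plus"
    and "hermitian_mat \<Omega>"
    and "\<C> = doubled_up C_minus C_plus"
    and "\<B> = - flat_mat m n \<C>"
    and "\<A> = (- \<i>) \<cdot>\<^sub>m (signature_mat n * \<Omega>) - (1 / 2) \<cdot>\<^sub>m (flat_mat m n \<C> * \<C>)"
    and "hurwitz_stable \<A>"
  shows "controllable \<A> \<B> \<and> observable \<A> \<C>"
proof
  have \<Omega>: "\<Omega> \<in> carrier_mat (n + n) (n + n)" and C: "\<C> \<in> carrier_mat (m + m) (n + n)"
    using assms(1-4) by (auto simp: assms(5,7) doubled_up_def)
  define P where "P = signature_mat n * \<Omega>"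
  define Q where "Q = flat_mat m n \<C> * \<C>"
  have P: "P \<in> carrier_mat (n + n) (n + n)" and Q: "Q \<in> carrier_mat (n + n) (n + n)"
    using \<Omega> C flat_mat_carrier[OF C] mult_carrier_mat signature_mat_carrier
    unfolding P_def Q_def by blast+
  have A_eq: "\<A> = (- \<i>) \<cdot>\<^sub>m P - (1 / 2) \<cdot>\<^sub>m Q" by (simp add: assms(9) P_def Q_def)
  then have A: "\<A> \<in> carrier_mat (n + n) (n + n)" using P Q by auto
  have B: "\<B> \<in> carrier_mat (n + n) (m + m)" using flat_mat_carrier[OF C] by (simp add: assms(8))
  \<comment> \<open>Reversing the product and using the involution returns the same product.\<close>
  have "flat_mat n n Q = Q"
    using flat_mat_mult[OF flat_mat_carrier[OF C] C] flat_mat_flat[OF C] by (simp add: Q_def)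
  then have "flat_mat n n \<A> = \<i> \<cdot>\<^sub>m P - (1 / 2) \<cdot>\<^sub>m Q"
    using flat_mat_linear[OF P Q] flat_mat_signature_hermitian[OF \<Omega> assms(6)]
    by (simp add: A_eq P_def)
  \<comment> \<open>Conjugation flips the sign of the imaginary coefficient, so the Hamiltonian
    parts cancel and the two halves of \<open>Q\<close> add up.\<close>
  then have dissipation: "\<A> + flat_mat n n \<A> = - (flat_mat m n \<C> * \<C>)"
    unfolding A_eq Q_def[symmetric] using P Q by (intro eq_matI) auto
  note flatA = flat_mat_carrier[OF A]
  have stable: "Re z < 0" if "eigenvalue \<A> z" for z
    using assms(10) that by (simp add: hurwitz_stable_def)

  show "observable \<A> \<C>"
  proof (rule observable_hautusI[OF A C], rule notI)
    fix y z assume y: "eigenvector \<A> y z" and Cy: "\<C> *\<^sub>v y = 0\<^sub>v (m + m)"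
    have y': "y \<in> carrier_vec (n + n)" "y \<noteq> 0\<^sub>v (n + n)" "\<A> *\<^sub>v y = z \<cdot>\<^sub>v y"
      using y A by (auto simp: eigenvector_def)
    have "flat_mat n n \<A> *\<^sub>v y = (- z) \<cdot>\<^sub>v y"
      using flat_mult_uncoupled_vec[OF A C dissipation y'(1) Cy] y'(3) by (intro eq_vecI) auto
    then have "eigenvalue (flat_mat n n \<A>) (- z)"
      using y' flatA by (auto simp: eigenvalue_def eigenvector_def)
    \<comment> \<open>Returning from the flat to the state matrix conjugates the eigenvalue, giving
      \<open>- cnj z\<close>, whose real part is opposite to that of \<open>z\<close>.\<close>
    then have "Re (cnj (- z)) < 0" using stable eigenvalue_flat[OF A] by blast
    moreover have "Re z < 0" using stable y by (auto simp: eigenvalue_def)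
    ultimately show False by simp
  qed

  show "controllable \<A> \<B>"
  proof (rule controllable_hautusI[OF A B], rule notI)
    fix y z assume y: "eigenvector \<A>\<^sup>T y z" and By: "\<B>\<^sup>T *\<^sub>v y = 0\<^sub>v (m + m)"
    \<comment> \<open>The right eigenvector of the flat of the state matrix that corresponds to the
      left eigenvector \<open>y\<close>.\<close>
    define v where "v = signature_mat n *\<^sub>v map_vec cnj y"
    have y': "y \<in> carrier_vec (n + n)" using y A by (simp add: eigenvector_def)
    have "eigenvector (flat_mat n n \<A>) v (cnj z)"
      unfolding v_def by (rule eigenvector_flat[OF A y])
    then have v: "v \<in> carrier_vec (n + n)" "v \<noteq> 0\<^sub>v (n + n)" "flat_mat n n \<A> *\<^sub>v v = cnj z \<cdot>\<^sub>v v"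
      using flatA by (auto simp: eigenvector_def)
    have "(flat_mat m n \<C>)\<^sup>T *\<^sub>v y = - (\<B>\<^sup>T *\<^sub>v y)"
      using y' flat_mat_carrier[OF C] by (intro eq_vecI) (auto simp: assms(8) transpose_uminus)
    then have "(flat_mat m n \<C>)\<^sup>T *\<^sub>v y = 0\<^sub>v (m + m)" using By by simp
    \<comment> \<open>\<open>flat_mat_mult_vec\<close> is applied to the flat of
      \<open>\<C>\<close>, whose flat is \<open>\<C>\<close> again; so \<open>v\<close> is decoupled
      from the output.\<close>
    then have "\<C> *\<^sub>v v = signature_mat m *\<^sub>v map_vec cnj (0\<^sub>v (m + m))"
      using flat_mat_mult_vec[OF flat_mat_carrier[OF C] y'] flat_mat_flat[OF C] by (simp add: v_def)
    also have "\<dots> = 0\<^sub>v (m + m)"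
      by (intro eq_vecI) (auto simp: scalar_prod_def signature_mat_def)
    finally have Cv: "\<C> *\<^sub>v v = 0\<^sub>v (m + m)" .
    have neg: "- (\<A> *\<^sub>v v) = cnj z \<cdot>\<^sub>v v"
      using flat_mult_uncoupled_vec[OF A C dissipation v(1) Cv] v(3) by simp
    have "\<A> *\<^sub>v v = - (- (\<A> *\<^sub>v v))" by simp
    also have "\<dots> = (- cnj z) \<cdot>\<^sub>v v" unfolding neg by (intro eq_vecI) auto
    finally have "eigenvalue \<A> (- cnj z)"
      using v A by (auto simp: eigenvalue_def eigenvector_def)
    \<comment> \<open>The left eigenvector \<open>y\<close> makes \<open>z\<close> an eigenvalue
      too, next to its mirror image \<open>- cnj z\<close>.\<close>
    moreover have "eigenvalue \<A> z"
      using y eigenvalue_transpose[OF A] by (auto simp: eigenvalue_def)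
    ultimately have "Re (- cnj z) < 0" "Re z < 0" using stable by blast+
    then show False by simp
  qed
qed

end
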